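(* Let $p,d\geq1$ and $\epsilon=(\epsilon_{ij})\in\{+1,-1\}^{p\times d}$. There exists $M>0$ such that for all real numbers $0<t_1<\cdots<t_p$ with $t_{i+1}/t_i>M$ for all $1\leq i\leq p-1$, the following holds: letting $C$ be the real $p\times d$ matrix $C_{ij}=\epsilon_{ij}t_i^{\,j-1}$ and $\mathcal{K}=\{x\in\mathbb{R}^d: x\geq0,\ Cx\geq0\}$, the extreme rays of the convex cone $\mathcal{K}$ are in one-to-one correspondence with the allowed lattice paths for the sign pattern $\epsilon$.
   Context: Inequalities $x\geq 0$, $Cx\geq0$ are entrywise. A lattice path in the $p\times d$ grid is specified by an integer $k\geq0$ and indices $1\leq i_1<\cdots<i_k\leq p$, $1\leq j_1<\cdots<j_{k+1}\leq d$; it is the sequence of positions $(1,j_1),\ldots,(i_1,j_1),\ldots,(i_1,j_2),\ldots,(i_2,j_2),\ldots,(i_k,j_{k+1}),\ldots,(p,j_{k+1})$. Its horizontal segments are row $i_r$ from column $j_r$ to column $j_{r+1}$ ($1\leq r\leq k$); its vertical segments are column $j_1$ rows $1$ to $i_1$ (initial), column $j_r$ rows $i_{r-1}$ to $i_r$ for $2\leq r\leq k$, and column $j_{k+1}$ rows $i_k$ to $p$ (final); for $k=0$ the only segment is column $j_1$, rows $1$ to $p$. The path is allowed for $\epsilon$ if: (C1) if $k\geq1$, $\epsilon_{ij_1}=+1$ for $1\leq i<i_1$; (C2) if $k\geq1$, $\epsilon_{ij_{k+1}}=+1$ for $i_k<i\leq p$, and if $k=0$, $\epsilon_{ij_1}=+1$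 for all $1\leq i\leq p$; (C3) for $2\leq r\leq k$, $\epsilon_{ij_r}=+1$ for $i_{r-1}<i<i_r$; (C4) for each $1\leq r\leq k$, $\epsilon_{i_rj_r}\epsilon_{i_rj_{r+1}}=-1$. *)

theory Defs
  imports Jordan_Normal_Form.Matrix
begin

(* Vectors and matrices from Jordan_Normal_Form are indexed from 0. Sign patterns, the
   parameters t, and positions in the p x d grid are indexed from 1. *)

definition signed_vandermonde ::
    "nat \<Rightarrow> nat \<Rightarrow> (nat \<Rightarrow> nat \<Rightarrow> real) \<Rightarrow> (nat \<Rightarrow> real) \<Rightarrow> real mat" where
  "signed_vandermonde p d \<epsilon> t =
     mat p d (\<lambda>(i, j). \<epsilon> (i + 1) (j + 1) * t (i + 1) ^ j)"

(* The order on vectors is entrywise. *)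
definition nonneg_cone :: "real mat \<Rightarrow> real vec set" where
  "nonneg_cone C =
     {x \<in> carrier_vec (dim_col C). 0\<^sub>v (dim_col C) \<le> x \<and> 0\<^sub>v (dim_row C) \<le> C *\<^sub>v x}"

definition ray :: "real vec \<Rightarrow> real vec set" where
  "ray x = {c \<cdot>\<^sub>v x | c. 0 \<le> c}"

definition extreme_rays :: "real vec set \<Rightarrow> real vec set set" where
  "extreme_rays K =
     {ray x | x. x \<in> K \<and> x \<noteq> 0\<^sub>v (dim_vec x) \<and>
        (\<forall>y\<in>K. \<forall>z\<in>K. y + z \<in> ray x \<longrightarrow> y \<in> ray x \<and> z \<in> ray x)}"

(* rs = [i_1, ..., i_k] and cs = [j_1, ..., j_(k+1)] *)
definition path_spec :: "nat \<Rightarrow> nat \<Rightarrow> nat list \<Rightarrow> nat list \<Rightarrow> bool" where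
  "path_spec p d rs cs \<longleftrightarrow>
     length cs = length rs + 1 \<and>
     sorted_wrt (<) rs \<and> set rs \<subseteq> {1..p} \<and>
     sorted_wrt (<) cs \<and> set cs \<subseteq> {1..d}"

(* The positions visited from row a, column hd cs onwards. Each position is listed once:
   a turning point is the first position of the segment that it starts. *)
fun path_from :: "nat \<Rightarrow> nat \<Rightarrow> nat list \<Rightarrow> nat list \<Rightarrow> (nat \<times> nat) list" where
  "path_from p a [] [j] = map (\<lambda>r. (r, j)) [a..<p + 1]"
| "path_from p a (i # rs) (j # j' # cs) =
     map (\<lambda>r. (r, j)) [a..<i] @ map (\<lambda>c. (i, c)) [j..<j'] @ path_from p i rs (j' # cs)"
| "path_from _ _ _ _ = []"

(* The list entries rs ! r and cs ! r are i_(r+1) and j_(r+1). The four conjuncts are the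
   sign conditions on the initial segment, the final segment, the intermediate vertical
   segments, and the endpoints of the horizontal segments. *)
definition allowed_spec ::
    "nat \<Rightarrow> (nat \<Rightarrow> nat \<Rightarrow> real) \<Rightarrow> nat list \<Rightarrow> nat list \<Rightarrow> bool" where
  "allowed_spec p \<epsilon> rs cs \<longleftrightarrow>
     (rs \<noteq> [] \<longrightarrow> (\<forall>i. 1 \<le> i \<and> i < hd rs \<longrightarrow> \<epsilon> i (hd cs) = 1)) \<and>
     (if rs \<noteq> [] then \<forall>i. last rs < i \<and> i \<le> p \<longrightarrow> \<epsilon> i (last cs) = 1
      else \<forall>i. 1 \<le> i \<and> i \<le> p \<longrightarrow> \<epsilon> i (hd cs) = 1) \<and>
     (\<forall>r. 1 \<le> r \<and> r < length rs \<longrightarrow>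
        (\<forall>i. rs ! (r - 1) < i \<and> i < rs ! r \<longrightarrow> \<epsilon> i (cs ! r) = 1)) \<and>
     (\<forall>r < length rs. \<epsilon> (rs ! r) (cs ! r) * \<epsilon> (rs ! r) (cs ! (r + 1)) = -1)"

definition allowed_lattice_paths ::
    "nat \<Rightarrow> nat \<Rightarrow> (nat \<Rightarrow> nat \<Rightarrow> real) \<Rightarrow> (nat \<times> nat) list set" where
  "allowed_lattice_paths p d \<epsilon> =
     {path_from p 1 rs cs | rs cs. path_spec p d rs cs \<and> allowed_spec p \<epsilon> rs cs}"

end

theory Submission
  imports Defs
begin

text \<open>For rows \<open>i\<^sub>1 < \<dots> < i\<^sub>k\<close> and columns \<open>j\<^sub>1 < \<dots> < j\<^sub>k\<^sub>+\<^sub>1\<close>, rescale column \<open>j\<^sub>s\<close> of the submatrix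
  of \<open>C\<close> by the product of \<open>t\<close>-powers that equalizes the two entries of row \<open>i\<^sub>r\<close> in columns \<open>j\<^sub>r\<close>
  and \<open>j\<^sub>r\<^sub>+\<^sub>1\<close>, for every \<open>r\<close>. After dividing each row by that common size, the submatrix is
  bidiagonal with entries \<open>\<plusminus>1\<close> up to errors \<open>1/M\<close>, so its kernel is a line, and the rescaled entries
  of a kernel vector \<open>x\<close> are all of nearly the same absolute value. Hence \<open>x \<ge> 0\<close> (after fixing the
  sign) amounts to (C4). In any other row exactly one rescaled entry dominates, namely the one in
  the column where the path crosses this row, so the remaining inequalities of \<open>C x \<ge> 0\<close> are strict
  and amount to (C1)--(C3). Conversely, an extreme vector with support \<open>S\<close> and set of active rows
  \<open>R\<close> satisfies \<open>card S = card R + 1\<close>: more active rows contradict the nonvanishing of the other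
  rows on the kernel, and fewer leave room for a perturbation inside the cone.\<close>

section \<open>Geometric chains, linear systems and perturbations\<close>

text \<open>Each step gains a factor \<open>N\<close>; one gain is kept and the others are only used
  as being at least 1. This carries a bound on neighbouring ratios over to any distance.\<close>

lemma geometric_chain:
  fixes f :: "nat \<Rightarrow> real"
  assumes "a < b" "1 \<le> N" "\<And>u. a \<le> u \<Longrightarrow> u \<le> b \<Longrightarrow> 0 \<le> f u"
    and "\<And>u. a \<le> u \<Longrightarrow> u < b \<Longrightarrow> N * f u \<le> f (Suc u)"
  shows "N * f a \<le> f b"
  using assms
proof (induction b)
  case (Suc b)
  show ?case
  proof (cases "a = b")
    case True
    then show ?thesis using Suc.prems by auto
  next
    case False
    then have "N * f a \<le> f b" using Suc by auto
    also have "\<dots> \<le> N * f b"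
      using Suc.prems(2) Suc.prems(3)[of b] \<open>a < Suc b\<close> by (simp add: mult_le_cancel_right1)
    also have "\<dots> \<le> f (Suc b)" using Suc.prems by auto
    finally show ?thesis .
  qed
qed simp

lemma geometric_chain_decreasing:
  fixes f :: "nat \<Rightarrow> real"
  assumes "a < b" "1 \<le> N" "\<And>u. a \<le> u \<Longrightarrow> u \<le> b \<Longrightarrow> 0 \<le> f u"
    and "\<And>u. a \<le> u \<Longrightarrow> u < b \<Longrightarrow> N * f (Suc u) \<le> f u"
  shows "N * f b \<le> f a"
  using assms
proof (induction b)
  case (Suc b)
  show ?case
  proof (cases "a = b")
    case True
    then show ?thesis using Suc.prems by auto
  next
    case False
    have "N * f (Suc b) \<le> f b" using Suc.prems by auto
    also have "\<dots> \<le> N * f b"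
      using Suc.prems(2) Suc.prems(3)[of b] \<open>a < Suc b\<close> by (simp add: mult_le_cancel_right1)
    also have "\<dots> \<le> f a" using Suc False by auto
    finally show ?thesis .
  qed
qed simp

text \<open>Gaussian elimination by induction on the equations: an equation with zero coefficients
  on \<open>S\<close> is dropped, and any other one is solved for a pivot unknown, which lowers both
  cardinalities by one.\<close>

lemma underdetermined_system:
  fixes A :: "'i \<Rightarrow> 'j \<Rightarrow> real"
  assumes "finite R" "finite S" "card R < card S"
  shows "\<exists>x. (\<exists>j\<in>S. x j \<noteq> 0) \<and> (\<forall>j. j \<notin> S \<longrightarrow> x j = 0) \<and> (\<forall>i\<in>R. (\<Sum>j\<in>S. A i j * x j) = 0)"
  using assms
proof (induction R arbitrary: S A rule: finite_induct)
  case empty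
  then obtain j where "j \<in> S" by fastforce
  then show ?case by (intro exI[of _ "\<lambda>l. if l = j then 1 else 0"]) auto
next
  case (insert i R)
  show ?case
  proof (cases "\<forall>j\<in>S. A i j = 0")
    case True
    moreover have "card R < card S" using insert by simp
    ultimately show ?thesis using insert.IH[OF insert.prems(1), of A] by auto
  next
    case False
    then obtain q where q: "q \<in> S" "A i q \<noteq> 0" by blast
    \<comment> \<open>\<open>B\<close> arises by subtracting from each row the multiple of row
      \<open>i\<close> that cancels column \<open>q\<close>.\<close>
    define B where "B = (\<lambda>r j. A r j - A r q * A i j / A i q)"
    have "card R < card (S - {q})" using insert q by simp
    then obtain x where x: "\<exists>j\<in>S - {q}. x j \<noteq> 0" "\<forall>j. j \<notin> S - {q} \<longrightarrow> x j = 0"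
        "\<forall>r\<in>R. (\<Sum>j\<in>S - {q}. B r j * x j) = 0"
      using insert.IH[of "S - {q}" B] insert.prems(1) by auto
    \<comment> \<open>The value at \<open>q\<close> is forced by equation \<open>i\<close>; by the
      choice of \<open>B\<close> the other equations then hold too.\<close>
    define c where "c = - (\<Sum>j\<in>S - {q}. A i j * x j) / A i q"
    define y where "y = x(q := c)"
    have split: "(\<Sum>j\<in>S. A r j * y j) = A r q * c + (\<Sum>j\<in>S - {q}. A r j * x j)" for r
      using q insert.prems(1) by (simp add: y_def sum.remove)
    have "(\<Sum>j\<in>S. A r j * y j) = 0" if "r \<in> R" for r
    proof -
      have "(\<Sum>j\<in>S - {q}. B r j * x j)
          = (\<Sum>j\<in>S - {q}. A r j * x j) - A r q / A i q * (\<Sum>j\<in>S - {q}. A i j * x j)"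
        by (simp add: B_def sum_distrib_left sum_subtractf algebra_simps)
      then show ?thesis using x(3) that unfolding split c_def by simp
    qed
    moreover have "(\<Sum>j\<in>S. A i j * y j) = 0" unfolding split c_def using q by simp
    moreover have "\<exists>j\<in>S. y j \<noteq> 0" "\<forall>j. j \<notin> S \<longrightarrow> y j = 0"
      using x(1,2) q by (auto simp: y_def)
    ultimately show ?thesis by blast
  qed
qed

text \<open>A positive \<open>a i\<close> allows a positive range of \<open>e\<close>, a zero one
  imposes nothing, and finitely many positive bounds have a positive minimum. The absolute value
  permits perturbing in both directions.\<close>

lemma small_perturbation:
  fixes a b :: "'i \<Rightarrow> real"
  assumes "finite I" "\<And>i. i \<in> I \<Longrightarrow> 0 \<le> a i" "\<And>i. i \<in> I \<Longrightarrow> a i = 0 \<Longrightarrow> b i = 0"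
  shows "\<exists>e>0. \<forall>i\<in>I. e * \<bar>b i\<bar> \<le> a i"
  using assms
proof (induction I rule: finite_induct)
  case empty
  show ?case by (intro exI[of _ 1]) simp
next
  case (insert i I)
  then obtain e where e: "0 < e" "\<forall>i\<in>I. e * \<bar>b i\<bar> \<le> a i" by auto
  obtain e' where e': "0 < e'" "e' * \<bar>b i\<bar> \<le> a i"
  proof (cases "b i = 0")
    case True
    then show ?thesis using that[of 1] insert.prems by simp
  next
    case False
    then have "0 < a i" using insert.prems by force
    then show ?thesis using that[of "a i / \<bar>b i\<bar>"] False by simp
  qed
  have "min e e' * \<bar>b l\<bar> \<le> e * \<bar>b l\<bar>" "min e e' * \<bar>b l\<bar> \<le> e' * \<bar>b l\<bar>" for l
    by (intro mult_right_mono; simp)+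
  then have "\<forall>l\<in>insert i I. min e e' * \<bar>b l\<bar> \<le> a l" using e e' by (auto intro: order_trans)
  then show ?case using e e' by (intro exI[of _ "min e e'"]) simp
qed

lemma four_times_square_ge_1:
  assumes "1 \<le> d"
  shows "1 \<le> 4 * (real d)\<^sup>2"
proof -
  have "1 \<le> (real d)\<^sup>2" using assms by (intro one_le_power) simp
  then show ?thesis by simp
qed

section \<open>Lattice paths\<close>

lemma strictly_sorted_gap:
  fixes rs :: "nat list"
  assumes "sorted_wrt (<) rs" "i \<notin> set rs"
  obtains r where "r \<le> length rs" "\<And>s. s < r \<Longrightarrow> rs ! s < i"
    "\<And>s. r \<le> s \<Longrightarrow> s < length rs \<Longrightarrow> i < rs ! s"
proof -
  \<comment> \<open>The disjunct \<open>r = length rs\<close> provides a value when no entry exceeds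
    \<open>i\<close>.\<close>
  define r where "r = (LEAST r. r = length rs \<or> i < rs ! r)"
  have r: "r = length rs \<or> i < rs ! r"
    unfolding r_def by (rule LeastI[of _ "length rs"]) simp
  have le: "r \<le> length rs" unfolding r_def by (rule Least_le) simp
  show ?thesis
  proof (rule that[OF le])
    fix s assume "s < r"
    then have "\<not> (s = length rs \<or> i < rs ! s)" unfolding r_def by (rule not_less_Least)
    moreover have "rs ! s \<in> set rs" using \<open>s < r\<close> le by simp
    ultimately show "rs ! s < i" using assms(2) by (metis linorder_neqE_nat)
  next
    fix s assume "r \<le> s" "s < length rs"
    then have "i < rs ! r" "rs ! r \<le> rs ! s"
      using r assms(1) by (cases "r = s"; auto simp: sorted_wrt_iff_nth_less less_imp_le)+
    then show "i < rs ! s" by auto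
  qed
qed

text \<open>(C1)--(C3) are one condition: a row without a turn is crossed in column
  \<open>cs ! r\<close>, where \<open>r\<close> counts the turning rows before it, and the sign
  there is +1. The initial, intermediate and final segments and the case k = 0 differ only in the
  value of \<open>r\<close>.\<close>

lemma allowed_spec_iff:
  assumes spec: "path_spec p d rs cs"
  shows "allowed_spec p \<epsilon> rs cs \<longleftrightarrow>
    (\<forall>r < length rs. \<epsilon> (rs ! r) (cs ! r) * \<epsilon> (rs ! r) (cs ! Suc r) = -1) \<and>
    (\<forall>i\<in>{1..p}. \<forall>r \<le> length rs. (\<forall>s<r. rs ! s < i) \<and> (\<forall>s. r \<le> s \<and> s < length rs \<longrightarrow> i < rs ! s)
       \<longrightarrow> \<epsilon> i (cs ! r) = 1)" (is "_ \<longleftrightarrow> ?S \<and> ?G")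
proof -
  let ?k = "length rs"
  have len: "length cs = Suc ?k" and srt: "sorted_wrt (<) rs" and sub: "set rs \<subseteq> {1..p}"
    using spec by (auto simp: path_spec_def)
  have mono: "rs ! a \<le> rs ! b" if "a \<le> b" "b < ?k" for a b
    using that srt by (cases "a = b") (auto simp: sorted_wrt_iff_nth_less less_imp_le)
  have hdc: "hd cs = cs ! 0" and lastc: "last cs = cs ! ?k"
    using len by (auto simp: hd_conv_nth last_conv_nth simp flip: length_greater_0_conv)
  have hdr: "hd rs = rs ! 0" and lastr: "last rs = rs ! (?k - 1)" if "rs \<noteq> []"
    using that by (auto simp: hd_conv_nth last_conv_nth)
  have inP: "rs ! s \<in> {1..p}" if "s < ?k" for s using sub that nth_mem by blast
  show ?thesis
  proof (intro iffI conjI)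
    assume al: "allowed_spec p \<epsilon> rs cs"
    then show ?S by (simp add: allowed_spec_def)
    show ?G
    proof (intro ballI allI impI)
      fix i r
      assume i: "i \<in> {1..p}" and r: "r \<le> ?k"
        and g: "(\<forall>s<r. rs ! s < i) \<and> (\<forall>s. r \<le> s \<and> s < ?k \<longrightarrow> i < rs ! s)"
      consider "rs = []" | "rs \<noteq> []" "r = 0" | "rs \<noteq> []" "r = ?k" | "1 \<le> r" "r < ?k"
        using r by force
      then show "\<epsilon> i (cs ! r) = 1"
      proof cases
        case 1 then show ?thesis using al i r hdc by (auto simp: allowed_spec_def)
      next
        case 2 then show ?thesis using al i g hdc hdr by (auto simp: allowed_spec_def)
      next
        case 3 then show ?thesis using al i g lastc lastr by (auto simp: allowed_spec_def)
      next
        case 4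
        then have "rs ! (r - 1) < i" "i < rs ! r" using g by auto
        then show ?thesis using al 4 unfolding allowed_spec_def by blast
      qed
    qed
  next
    assume SG: "?S \<and> ?G"
    \<comment> \<open>Since \<open>rs\<close> is sorted, only the neighbouring turns
      \<open>r - 1\<close> and \<open>r\<close> need checking; the disjuncts cover the two ends,
      where one of them is missing.\<close>
    have G: "\<epsilon> i (cs ! r) = 1" if "i \<in> {1..p}" "r \<le> ?k" "r = 0 \<or> rs ! (r - 1) < i" "r = ?k \<or> i < rs ! r" for i r
    proof -
      have "rs ! s < i" if "s < r" for s
        using mono[of s "r - 1"] that \<open>r = 0 \<or> _\<close> \<open>r \<le> ?k\<close> by fastforce
      moreover have "i < rs ! s" if "r \<le> s" "s < ?k" for s
        using mono[of r s] that \<open>r = ?k \<or> _\<close> by auto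
      ultimately show ?thesis using SG that by blast
    qed
    have "\<epsilon> i (hd cs) = 1" if "rs \<noteq> []" "1 \<le> i" "i < hd rs" for i
      using G[of i 0] inP[of 0] that by (auto simp: hdc hdr)
    moreover have "\<epsilon> i (last cs) = 1" if "rs \<noteq> []" "last rs < i" "i \<le> p" for i
      using G[of i ?k] that by (auto simp: lastc lastr)
    moreover have "\<epsilon> i (hd cs) = 1" if "rs = []" "1 \<le> i" "i \<le> p" for i
      using G[of i 0] that by (auto simp: hdc)
    moreover have "\<epsilon> i (cs ! r) = 1" if "1 \<le> r" "r < ?k" "rs ! (r - 1) < i" "i < rs ! r" for i r
      using G[of i r] inP[of r] that by auto
    ultimately show "allowed_spec p \<epsilon> rs cs"
      using SG unfolding allowed_spec_def by auto
  qed
qed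

section \<open>Position lists and the turning points they determine\<close>

lemma path_from_head:
  assumes "length cs = Suc (length rs)" "sorted_wrt (<) cs" "\<forall>i\<in>set rs. a \<le> i" "a \<le> p"
  shows "\<exists>xs. path_from p a rs cs = (a, hd cs) # xs"
proof (cases rs)
  case Nil
  then obtain j where "cs = [j]" using assms(1) by (auto simp: length_Suc_conv)
  then show ?thesis using Nil assms(4) by (simp add: upt_conv_Cons del: upt_Suc)
next
  case (Cons i rs')
  then obtain j j' cs' where cs: "cs = j # j' # cs'" using assms(1) by (auto simp: length_Suc_conv)
  then have "j < j'" "a \<le> i" using assms Cons by auto
  then show ?thesis using Cons cs by (cases "a = i") (auto simp: upt_conv_Cons)
qed

text \<open>The last conjunct holds because horizontal moves happen only in turning rows; it serves
  to read off a turn from the set of visited positions.\<close>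

lemma path_from_range:
  assumes "length cs = Suc (length rs)" "sorted_wrt (<) cs" "sorted_wrt (<) rs"
    "\<forall>i\<in>set rs. a \<le> i \<and> i \<le> p" "(r, c) \<in> set (path_from p a rs cs)"
  shows "a \<le> r \<and> r \<le> p \<and> hd cs \<le> c \<and> ((\<forall>i\<in>set rs. a < i) \<and> r = a \<longrightarrow> c = hd cs)"
  using assms
proof (induction p a rs cs rule: path_from.induct)
  case (2 p a i rs j j' cs)
  have "(r, c) \<in> set (path_from p i rs (j' # cs)) \<Longrightarrow> i \<le> r \<and> r \<le> p \<and> j' \<le> c"
    using 2 by (auto simp: less_imp_le)
  then show ?case using 2(2-) by auto
qed auto

text \<open>The first turn can be read off from the visited positions: the first column is met
  exactly in rows \<open>a\<close> to \<open>i\<close>, and row \<open>i\<close> exactly from the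
  first to the second column. The remaining lists then agree, and induction applies.\<close>

lemma path_from_inj:
  assumes "length cs = Suc (length rs)" "sorted_wrt (<) cs" "sorted_wrt (<) rs"
    "\<forall>i\<in>set rs. a \<le> i \<and> i \<le> p"
    and "length cs' = Suc (length rs')" "sorted_wrt (<) cs'" "sorted_wrt (<) rs'"
    "\<forall>i\<in>set rs'. a \<le> i \<and> i \<le> p"
    and "a \<le> p" "path_from p a rs cs = path_from p a rs' cs'"
  shows "rs = rs' \<and> cs = cs'"
  using assms
proof (induction rs arbitrary: a cs rs' cs')
  case Nil
  then obtain j where cs: "cs = [j]" by (auto simp: length_Suc_conv)
  have hd': "hd cs' = j"
    using path_from_head[of cs' rs' a p] path_from_head[of cs "[]" a p] Nil cs by auto
  show ?case
  proof (cases rs')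
    case Nil
    then show ?thesis using cs hd' \<open>length cs' = _\<close> by (auto simp: length_Suc_conv)
  next
    case (Cons i' rs'')
    then obtain j'' cs'' where cs': "cs' = j # j'' # cs''"
      using hd' \<open>length cs' = _\<close> by (auto simp: length_Suc_conv)
    have "\<exists>xs. path_from p i' rs'' (j'' # cs'') = (i', j'') # xs"
      using path_from_head[of "j'' # cs''" rs'' i' p] Nil.prems cs' Cons by (auto simp: less_imp_le)
    then have "(i', j'') \<in> set (path_from p a rs' cs')" using cs' Cons by auto
    \<comment> \<open>A path with a turn reaches a column beyond \<open>j\<close>, whereas the path
      without turns stays in column \<open>j\<close>.\<close>
    then have "(i', j'') \<in> set (path_from p a [] [j])" using Nil.prems(10) cs by metis
    then have "j'' = j" by auto
    then show ?thesis using cs' Nil.prems by auto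
  qed
next
  case (Cons i rs)
  then obtain j j2 cs2 where cs: "cs = j # j2 # cs2" by (auto simp: length_Suc_conv)
  have hd': "hd cs' = j"
    using path_from_head[of cs' rs' a p] path_from_head[of cs "i # rs" a p] Cons.prems cs by auto
  have rest: "\<exists>xs. path_from p i rs (j2 # cs2) = (i, j2) # xs"
    using path_from_head[of "j2 # cs2" rs i p] Cons.prems cs by (auto simp: less_imp_le)
  show ?case
  proof (cases rs')
    case Nil
    then have cs': "cs' = [j]" using hd' \<open>length cs' = _\<close> by (auto simp: length_Suc_conv)
    have "(i, j2) \<in> set (path_from p a (i # rs) cs)" using rest cs by auto
    then have "j2 = j" using Cons.prems(10) cs' Nil by auto
    then show ?thesis using cs Cons.prems by auto
  next
    case (Cons i' rs2')
    note r' = Cons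
    then obtain j2' cs2' where cs': "cs' = j # j2' # cs2'"
      using hd' \<open>length cs' = _\<close> by (auto simp: length_Suc_conv)
    have rest': "\<exists>xs. path_from p i' rs2' (j2' # cs2') = (i', j2') # xs"
      using path_from_head[of "j2' # cs2'" rs2' i' p] Cons.prems cs' r' by (auto simp: less_imp_le)
    note rng = path_from_range[of "j2 # cs2" rs i p]
    note rng' = path_from_range[of "j2' # cs2'" rs2' i' p]
    have R: "i \<le> r \<and> r \<le> p \<and> j2 \<le> c \<and> (r = i \<longrightarrow> c = j2)"
      if "(r, c) \<in> set (path_from p i rs (j2 # cs2))" for r c
      using rng[OF _ _ _ _ that] Cons.prems cs by (auto simp: less_imp_le)
    have R': "i' \<le> r \<and> r \<le> p \<and> j2' \<le> c \<and> (r = i' \<longrightarrow> c = j2')"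
      if "(r, c) \<in> set (path_from p i' rs2' (j2' # cs2'))" for r c
      using rng'[OF _ _ _ _ that] Cons.prems cs' r' by (auto simp: less_imp_le)
    have j: "j < j2" "j < j2'" "a \<le> i" "a \<le> i'" using Cons.prems cs cs' r' by auto
    have eq: "set (path_from p a (i # rs) cs) = set (path_from p a rs' cs')"
      using Cons.prems(10) by simp
    have col: "(r, j) \<in> set (path_from p a (i # rs) cs) \<longleftrightarrow> a \<le> r \<and> r \<le> i" for r
      using R[of r j] j cs by (cases "r = i") (auto simp: image_iff)
    have col': "(r, j) \<in> set (path_from p a rs' cs') \<longleftrightarrow> a \<le> r \<and> r \<le> i'" for r
      using R'[of r j] j cs' r' by (cases "r = i'") (auto simp: image_iff)
    have ii: "i' = i" using col[of i] col'[of i] col[of i'] col'[of i'] j eq by auto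
    have row: "(i, c) \<in> set (path_from p a (i # rs) cs) \<longleftrightarrow> j \<le> c \<and> c \<le> j2" for c
      using R[of i c] j cs rest by (cases "c = j2") (auto simp: image_iff)
    have row': "(i, c) \<in> set (path_from p a rs' cs') \<longleftrightarrow> j \<le> c \<and> c \<le> j2'" for c
      using R'[of i c] j cs' r' rest' ii by (cases "c = j2'") (auto simp: image_iff)
    have jj: "j2' = j2" using row[of j2] row'[of j2] row[of j2'] row'[of j2'] j eq by auto
    have "path_from p i rs (j2 # cs2) = path_from p i rs2' (j2 # cs2')"
      using Cons.prems(10) cs cs' r' ii jj by simp
    then have "rs = rs2' \<and> j2 # cs2 = j2 # cs2'"
      using Cons.IH[of "j2 # cs2" i "j2 # cs2'" rs2'] Cons.prems cs cs' r' ii jj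
      by (auto simp: less_imp_le)
    then show ?thesis using cs cs' r' ii jj by simp
  qed
qed

section \<open>Kernel vectors of rescaled submatrices\<close>

text \<open>In the ratio 4 d^2, one factor d absorbs the number of terms in a row sum, the other the
  number of turns along which errors accumulate; the 4 leaves a total relative error of 1/4.\<close>

locale separated_pattern =
  fixes p d :: nat and \<epsilon> :: "nat \<Rightarrow> nat \<Rightarrow> real" and t :: "nat \<Rightarrow> real"
  assumes d_ge_1: "1 \<le> d"
    and sign: "i \<in> {1..p} \<Longrightarrow> j \<in> {1..d} \<Longrightarrow> \<bar>\<epsilon> i j\<bar> = 1"
    and t_pos: "i \<in> {1..p} \<Longrightarrow> 0 < t i"
    and separated: "i \<in> {1..p} \<Longrightarrow> i' \<in> {1..p} \<Longrightarrow> i < i' \<Longrightarrow> 4 * (real d)\<^sup>2 * t i \<le> t i'"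
begin

text \<open>The entry of \<open>C x\<close> in row \<open>i\<close>, for \<open>x\<close> indexed from 1.\<close>
definition row_sum :: "nat \<Rightarrow> (nat \<Rightarrow> real) \<Rightarrow> real" where
  "row_sum i x = (\<Sum>j\<in>{1..d}. \<epsilon> i j * t i ^ (j - 1) * x j)"

lemmas ratio_ge_1 = four_times_square_ge_1[OF d_ge_1]

lemma row_sum_add: "row_sum i (\<lambda>j. x j + y j) = row_sum i x + row_sum i y"
  by (simp add: row_sum_def distrib_left sum.distrib)

lemma row_sum_scale: "row_sum i (\<lambda>j. c * x j) = c * row_sum i x"
  by (simp add: row_sum_def sum_distrib_left mult_ac)

lemma row_sum_cong: "(\<And>j. j \<in> {1..d} \<Longrightarrow> x j = y j) \<Longrightarrow> row_sum i x = row_sum i y"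
  unfolding row_sum_def by (rule sum.cong) simp_all

text \<open>Positivity in the first column fixes the sign of a vector on the kernel line. The
  definition is stated outside the locale of a single path so that vectors of different paths can be
  compared.\<close>

definition generator :: "nat list \<Rightarrow> nat list \<Rightarrow> real vec \<Rightarrow> bool" where
  "generator rs cs v \<longleftrightarrow> v \<in> carrier_vec d \<and> (\<forall>j\<in>{1..d} - set cs. v $ (j - 1) = 0) \<and>
     (\<forall>i\<in>set rs. row_sum i (\<lambda>j. v $ (j - 1)) = 0) \<and> 0 < v $ (hd cs - 1)"

lemma mem_cone_iff:
  "v \<in> nonneg_cone (signed_vandermonde p d \<epsilon> t) \<longleftrightarrow>
     v \<in> carrier_vec d \<and> (\<forall>j\<in>{1..d}. 0 \<le> v $ (j - 1)) \<and>
     (\<forall>i\<in>{1..p}. 0 \<le> row_sum i (\<lambda>j. v $ (j - 1)))"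
proof (cases "v \<in> carrier_vec d")
  case True
  let ?C = "signed_vandermonde p d \<epsilon> t"
  have shift: "(\<forall>j\<in>{1..n}. P (j - 1)) \<longleftrightarrow> (\<forall>j<n. P j)" for n and P :: "nat \<Rightarrow> bool"
  proof (intro iffI ballI allI impI)
    fix j assume "\<forall>j\<in>{1..n}. P (j - 1)" "j < n"
    then show "P j" by (auto dest: bspec[of _ _ "Suc j"])
  qed auto
  have "(?C *\<^sub>v v) $ (i - 1) = row_sum i (\<lambda>j. v $ (j - 1))" if "i \<in> {1..p}" for i
  proof -
    have "(?C *\<^sub>v v) $ (i - 1) = (\<Sum>j = 0..<d. \<epsilon> i (j + 1) * t i ^ j * v $ j)"
      using that True by (cases i) (auto simp: signed_vandermonde_def scalar_prod_def)
    also have "\<dots> = (\<Sum>j = 1..<Suc d. \<epsilon> i j * t i ^ (j - 1) * v $ (j - 1))"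
      using sum.shift_bounds_Suc_ivl[of "\<lambda>j. \<epsilon> i j * t i ^ (j - 1) * v $ (j - 1)" 0 d] by simp
    also have "\<dots> = row_sum i (\<lambda>j. v $ (j - 1))"
      by (simp add: row_sum_def atLeastLessThanSuc_atLeastAtMost)
    finally show ?thesis .
  qed
  then have rows: "(\<forall>i\<in>{1..p}. 0 \<le> row_sum i (\<lambda>j. v $ (j - 1))) \<longleftrightarrow> (\<forall>i<p. 0 \<le> (?C *\<^sub>v v) $ i)"
    using shift[of p "\<lambda>i. 0 \<le> (?C *\<^sub>v v) $ i"] by auto
  have dims: "dim_row ?C = p" "dim_col ?C = d" by (auto simp: signed_vandermonde_def)
  show ?thesis
    unfolding rows shift[of d "\<lambda>j. 0 \<le> v $ j"]
    using True by (simp add: nonneg_cone_def dims less_eq_vec_def)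
next
  case False
  then show ?thesis by (simp add: nonneg_cone_def signed_vandermonde_def)
qed

end

locale lattice_path = separated_pattern +
  fixes rs cs :: "nat list"
  assumes spec: "path_spec p d rs cs"
begin

abbreviation "k \<equiv> length rs"

text \<open>The scaling factors are chosen so that row \<open>rs ! s\<close> has equal weights at \<open>s\<close> and \<open>s + 1\<close>; as a
  consequence \<open>weight i\<close> increases at \<open>s\<close> if \<open>rs ! s < i\<close> and decreases if \<open>i < rs ! s\<close>, each time
  by a factor of at least \<open>M = 4 d\<^sup>2\<close>.\<close>
definition scale :: "nat \<Rightarrow> real" where
  "scale s = (\<Prod>u<s. 1 / t (rs ! u) ^ (cs ! Suc u - cs ! u))"

definition weight :: "nat \<Rightarrow> nat \<Rightarrow> real" where
  "weight i s = t i ^ (cs ! s - 1) * scale s"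

text \<open>Coordinates with respect to the rescaled columns: the term of row \<open>i\<close> in
  column \<open>cs ! s\<close> becomes its sign times \<open>weight i s * coord x s\<close>. The
  maximum norm in these coordinates is \<open>height\<close>.\<close>

definition coord :: "(nat \<Rightarrow> real) \<Rightarrow> nat \<Rightarrow> real" where
  "coord x s = x (cs ! s) / scale s"

definition height :: "(nat \<Rightarrow> real) \<Rightarrow> real" where
  "height x = Max ((\<lambda>s. \<bar>coord x s\<bar>) ` {..k})"

definition supported :: "(nat \<Rightarrow> real) \<Rightarrow> bool" where
  "supported x \<longleftrightarrow> (\<forall>j\<in>{1..d} - set cs. x j = 0)"

definition in_kernel :: "(nat \<Rightarrow> real) \<Rightarrow> bool" where
  "in_kernel x \<longleftrightarrow> supported x \<and> (\<forall>i\<in>set rs. row_sum i x = 0)"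

text \<open>The path crosses row \<open>i\<close> in column \<open>cs ! r\<close>, inside a vertical segment.\<close>
definition gap :: "nat \<Rightarrow> nat \<Rightarrow> bool" where
  "gap i r \<longleftrightarrow> r \<le> k \<and> (\<forall>s<r. rs ! s < i) \<and> (\<forall>s. r \<le> s \<and> s < k \<longrightarrow> i < rs ! s)"

lemma length_cs: "length cs = Suc k"
  using spec by (simp add: path_spec_def)

lemma rs_in: "s < k \<Longrightarrow> rs ! s \<in> {1..p}"
  using spec nth_mem unfolding path_spec_def by blast

lemma cs_in: "s \<le> k \<Longrightarrow> cs ! s \<in> {1..d}"
  using spec nth_mem[of s cs] length_cs unfolding path_spec_def by (simp add: subset_iff)

lemma cs_less: "r < s \<Longrightarrow> s \<le> k \<Longrightarrow> cs ! r < cs ! s"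
  using spec length_cs unfolding path_spec_def by (auto simp: sorted_wrt_iff_nth_less)

lemma rs_less: "r < s \<Longrightarrow> s < k \<Longrightarrow> rs ! r < rs ! s"
  using spec unfolding path_spec_def by (auto simp: sorted_wrt_iff_nth_less)

lemma distinct_rs: "distinct rs" and distinct_cs: "distinct cs"
  using spec unfolding path_spec_def by (auto simp: strict_sorted_iff)

lemma k_less_d: "k < d"
proof -
  have "card (set cs) \<le> card {1..d}"
    using spec by (intro card_mono) (auto simp: path_spec_def)
  then show ?thesis using distinct_card[OF distinct_cs] length_cs by simp
qed

section \<open>Growth and decay of the weights of a row along the path\<close>

lemma scale_pos: "s \<le> k \<Longrightarrow> 0 < scale s"
  unfolding scale_def using rs_in t_pos by (intro prod_pos) auto

lemma weight_pos: "i \<in> {1..p} \<Longrightarrow> s \<le> k \<Longrightarrow> 0 < weight i s"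
  unfolding weight_def using scale_pos t_pos by simp

text \<open>The \<open>t\<close>-power and the scaling factor both change by a power whose exponent
  is the column gap, so only the ratio of \<open>t i\<close> to the parameter of the turning row
  matters.\<close>

lemma weight_Suc:
  assumes "s < k" "i \<in> {1..p}"
  shows "weight i (Suc s) = weight i s * (t i / t (rs ! s)) ^ (cs ! Suc s - cs ! s)"
proof -
  \<comment> \<open>Columns start at 1 and increase, so the truncated subtractions are
    exact.\<close>
  have "cs ! Suc s - 1 = (cs ! s - 1) + (cs ! Suc s - cs ! s)"
    using cs_less[of s "Suc s"] cs_in[of s] assms by auto
  then have "t i ^ (cs ! Suc s - 1) = t i ^ (cs ! s - 1) * t i ^ (cs ! Suc s - cs ! s)"
    by (metis power_add)
  then show ?thesis by (simp add: weight_def scale_def power_divide)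
qed

lemma weight_tie: "s < k \<Longrightarrow> weight (rs ! s) (Suc s) = weight (rs ! s) s"
  using weight_Suc[of s "rs ! s"] rs_in[of s] t_pos[of "rs ! s"] by simp

lemma weight_increase:
  assumes "s < k" "i \<in> {1..p}" "rs ! s < i"
  shows "4 * (real d)\<^sup>2 * weight i s \<le> weight i (Suc s)"
proof -
  let ?e = "cs ! Suc s - cs ! s"
  have e: "1 \<le> ?e" using cs_less[of s "Suc s"] assms by auto
  have q: "4 * (real d)\<^sup>2 \<le> t i / t (rs ! s)"
    using separated[of "rs ! s" i] rs_in[of s] t_pos[of "rs ! s"] assms by (simp add: pos_le_divide_eq)
  also have "\<dots> \<le> (t i / t (rs ! s)) ^ ?e"
    using q ratio_ge_1 e by (intro self_le_power) auto
  finally show ?thesis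
    using weight_Suc[OF assms(1,2)] weight_pos[of i s] assms by (simp add: mult.commute)
qed

lemma weight_decrease:
  assumes "s < k" "i \<in> {1..p}" "i < rs ! s"
  shows "4 * (real d)\<^sup>2 * weight i (Suc s) \<le> weight i s"
proof -
  let ?e = "cs ! Suc s - cs ! s" and ?q = "t i / t (rs ! s)"
  have e: "1 \<le> ?e" using cs_less[of s "Suc s"] assms by auto
  have pos: "0 < t i" "0 < t (rs ! s)" using rs_in t_pos assms by auto
  have q: "4 * (real d)\<^sup>2 * ?q \<le> 1"
    using separated[of i "rs ! s"] rs_in[of s] pos assms by simp
  \<comment> \<open>With \<open>?q\<close> at most 1, its power with exponent at least 1 is bounded
    by \<open>?q\<close> itself.\<close>
  have "?q \<le> 4 * (real d)\<^sup>2 * ?q"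
    using mult_right_mono[OF ratio_ge_1, of ?q] pos by simp
  then have "?q \<le> 1" using q by linarith
  then have "?q ^ ?e \<le> ?q ^ 1" using e pos by (intro power_decreasing) auto
  then have "4 * (real d)\<^sup>2 * ?q ^ ?e \<le> 4 * (real d)\<^sup>2 * ?q"
    using ratio_ge_1 by (intro mult_left_mono) auto
  then have "4 * (real d)\<^sup>2 * ?q ^ ?e \<le> 1" using q by linarith
  then have "weight i s * (4 * (real d)\<^sup>2 * ?q ^ ?e) \<le> weight i s * 1"
    using weight_pos[of i s] assms by (intro mult_left_mono) auto
  then show ?thesis using weight_Suc[OF assms(1,2)] by (simp add: mult_ac)
qed

lemma weight_left:
  assumes "i \<in> {1..p}" "s < r" "r \<le> k" "\<And>u. u < r \<Longrightarrow> rs ! u < i"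
  shows "4 * (real d)\<^sup>2 * weight i s \<le> weight i r"
proof (rule geometric_chain[OF assms(2) ratio_ge_1])
  show "0 \<le> weight i u" if "u \<le> r" for u
    using weight_pos[OF assms(1), of u] that assms(3) by simp
  show "4 * (real d)\<^sup>2 * weight i u \<le> weight i (Suc u)" if "u < r" for u
    using weight_increase[of u i] assms that by simp
qed

lemma weight_right:
  assumes "i \<in> {1..p}" "r < s" "s \<le> k" "\<And>u. r \<le> u \<Longrightarrow> u < k \<Longrightarrow> i < rs ! u"
  shows "4 * (real d)\<^sup>2 * weight i s \<le> weight i r"
proof (rule geometric_chain_decreasing[OF assms(2) ratio_ge_1])
  show "0 \<le> weight i u" if "u \<le> s" for u
    using weight_pos[OF assms(1), of u] that assms(3) by simp
  show "4 * (real d)\<^sup>2 * weight i (Suc u) \<le> weight i u" if "r \<le> u" "u < s" for u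
    using weight_decrease[of u i] assms that by simp
qed

section \<open>Dominant terms of row sums and the size of kernel coordinates\<close>

lemma coord_le_height: "s \<le> k \<Longrightarrow> \<bar>coord x s\<bar> \<le> height x"
  unfolding height_def by (intro Max_ge) auto

lemma height_attained: obtains s where "s \<le> k" "height x = \<bar>coord x s\<bar>"
proof -
  have "height x \<in> (\<lambda>s. \<bar>coord x s\<bar>) ` {..k}" unfolding height_def by (intro Max_in) auto
  then show ?thesis using that by auto
qed

lemma row_supported:
  assumes "supported x" "i \<in> {1..p}"
  shows "row_sum i x = (\<Sum>s\<le>k. \<epsilon> i (cs ! s) * weight i s * coord x s)"
proof -
  have "row_sum i x = (\<Sum>j\<in>set cs. \<epsilon> i j * t i ^ (j - 1) * x j)"
    unfolding row_sum_def using assms spec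
    by (intro sum.mono_neutral_right) (auto simp: supported_def path_spec_def)
  also have "\<dots> = (\<Sum>s\<in>{..<length cs}. \<epsilon> i (cs ! s) * t i ^ (cs ! s - 1) * x (cs ! s))"
    using bij_betw_nth[OF distinct_cs refl refl] by (intro sum.reindex_bij_betw[symmetric])
  also have "\<dots> = (\<Sum>s\<le>k. \<epsilon> i (cs ! s) * weight i s * coord x s)"
  proof (rule sum.cong)
    show "{..<length cs} = {..k}" using length_cs by auto
    fix s assume "s \<in> {..k}"
    then show "\<epsilon> i (cs ! s) * t i ^ (cs ! s - 1) * x (cs ! s) = \<epsilon> i (cs ! s) * weight i s * coord x s"
      using scale_pos[of s] by (simp add: weight_def coord_def)
  qed
  finally show ?thesis .
qed

text \<open>\<open>B\<close> holds the dominant positions: one for a crossed row, two for a turning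
  row. Each other term is at most W / (4 d^2) times the height, and there are at most d of
  them.\<close>

lemma row_estimate:
  assumes x: "supported x" and i: "i \<in> {1..p}" and B: "B \<subseteq> {..k}" "B \<noteq> {}"
    and W: "\<And>s. s \<le> k \<Longrightarrow> s \<notin> B \<Longrightarrow> 4 * (real d)\<^sup>2 * weight i s \<le> W" and "0 < W"
  shows "\<bar>row_sum i x - (\<Sum>s\<in>B. \<epsilon> i (cs ! s) * weight i s * coord x s)\<bar> \<le> W * height x / (4 * real d)"
proof -
  let ?f = "\<lambda>s. \<epsilon> i (cs ! s) * weight i s * coord x s"
  have d: "0 < real d" using d_ge_1 by simp
  have h: "0 \<le> height x" using coord_le_height[of 0 x] by (meson abs_ge_zero order_trans le0)
  have "row_sum i x - sum ?f B = sum ?f ({..k} - B)"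
    unfolding row_supported[OF x i] using B by (simp add: sum_diff)
  also have "\<bar>\<dots>\<bar> \<le> (\<Sum>s\<in>{..k} - B. \<bar>?f s\<bar>)" by (rule sum_abs)
  also have "\<dots> \<le> of_nat (card ({..k} - B)) * (W / (4 * (real d)\<^sup>2) * height x)"
  proof (rule sum_bounded_above)
    fix s assume s: "s \<in> {..k} - B"
    have "\<bar>?f s\<bar> = weight i s * \<bar>coord x s\<bar>"
      using s sign[OF i cs_in[of s]] weight_pos[OF i, of s] by (simp add: abs_mult)
    also have "\<dots> \<le> W / (4 * (real d)\<^sup>2) * height x"
      using s W[of s] coord_le_height[of s x] weight_pos[OF i, of s] d \<open>0 < W\<close>
      by (intro mult_mono) (auto simp: pos_le_divide_eq mult_ac)
    finally show "\<bar>?f s\<bar> \<le> W / (4 * (real d)\<^sup>2) * height x" .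
  qed
  also have "\<dots> \<le> real d * (W / (4 * (real d)\<^sup>2) * height x)"
  proof (rule mult_right_mono)
    have "card ({..k} - B) \<le> card {..k}" by (intro card_mono) auto
    then show "real (card ({..k} - B)) \<le> real d" using k_less_d by simp
  qed (use h d \<open>0 < W\<close> in simp)
  also have "\<dots> = W * height x / (4 * real d)" using d by (simp add: field_simps power2_eq_square)
  finally show ?thesis .
qed

lemma height_div_le: "height x / (4 * real d) \<le> height x / 4"
proof -
  have h: "0 \<le> height x" using coord_le_height[of 0 x] by (meson abs_ge_zero order_trans le0)
  then show ?thesis using d_ge_1 by (intro divide_left_mono) auto
qed

text \<open>The turns before \<open>r\<close> precede row \<open>i\<close> and the others follow it,
  so the weights rise up to \<open>r\<close> and fall afterwards.\<close>

lemma row_gap_estimate: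
  assumes "supported x" "i \<in> {1..p}" "gap i r"
  shows "\<bar>row_sum i x - weight i r * (\<epsilon> i (cs ! r) * coord x r)\<bar> \<le> weight i r * (height x / 4)"
proof -
  have r: "r \<le> k" using assms by (simp add: gap_def)
  have "4 * (real d)\<^sup>2 * weight i s \<le> weight i r" if "s \<le> k" "s \<notin> {r}" for s
    using weight_left[OF assms(2), of s r] weight_right[OF assms(2), of r s] that assms(3)
    by (auto simp: gap_def neq_iff)
  then have "\<bar>row_sum i x - (\<Sum>s\<in>{r}. \<epsilon> i (cs ! s) * weight i s * coord x s)\<bar>
      \<le> weight i r * height x / (4 * real d)"
    using r weight_pos assms by (intro row_estimate) auto
  also have "\<dots> \<le> weight i r * (height x / 4)"
    using mult_left_mono[OF height_div_le, of "weight i r" x] weight_pos[OF assms(2) r] by simp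
  finally show ?thesis by (simp add: mult_ac)
qed

text \<open>In a turning row the two equal weights dominate, and since the row sum is zero their
  terms nearly cancel. The error keeps its denominator d because such errors are added up along the
  path.\<close>

lemma row_tie_estimate:
  assumes "in_kernel x" "r < k"
  shows "\<bar>\<epsilon> (rs ! r) (cs ! r) * coord x r + \<epsilon> (rs ! r) (cs ! Suc r) * coord x (Suc r)\<bar>
    \<le> height x / (4 * real d)"
proof -
  let ?i = "rs ! r" and ?w = "weight (rs ! r) r"
  have i: "?i \<in> {1..p}" using rs_in assms by simp
  have wp: "0 < ?w" using weight_pos[OF i] assms by simp
  have W: "4 * (real d)\<^sup>2 * weight ?i s \<le> ?w" if s: "s \<le> k" "s \<notin> {r, Suc r}" for s
  proof (cases "s < r")
    case True
    then show ?thesis using assms rs_less by (intro weight_left[OF i]) auto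
  next
    case False
    \<comment> \<open>The turns after \<open>r\<close> lie in later rows, so the comparison is with
      position \<open>Suc r\<close>, which ties with \<open>r\<close>.\<close>
    then have "4 * (real d)\<^sup>2 * weight ?i s \<le> weight ?i (Suc r)"
      using assms rs_less s by (intro weight_right[OF i]) auto
    then show ?thesis using weight_tie assms by simp
  qed
  have "\<bar>row_sum ?i x - (\<Sum>s\<in>{r, Suc r}. \<epsilon> ?i (cs ! s) * weight ?i s * coord x s)\<bar>
      \<le> ?w * height x / (4 * real d)"
    using W assms wp i by (intro row_estimate) (auto simp: in_kernel_def)
  moreover have "(\<Sum>s\<in>{r, Suc r}. \<epsilon> ?i (cs ! s) * weight ?i s * coord x s)
      = ?w * (\<epsilon> ?i (cs ! r) * coord x r + \<epsilon> ?i (cs ! Suc r) * coord x (Suc r))"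
    using weight_tie[of r] assms by (simp add: algebra_simps)
  moreover have "row_sum ?i x = 0" using assms by (simp add: in_kernel_def)
  ultimately have "?w * \<bar>\<epsilon> ?i (cs ! r) * coord x r + \<epsilon> ?i (cs ! Suc r) * coord x (Suc r)\<bar>
      \<le> ?w * (height x / (4 * real d))"
    using wp by (simp add: abs_mult)
  then show ?thesis using wp by (simp only: mult_le_cancel_left_pos)
qed

text \<open>By the tie estimates neighbouring coordinates differ in absolute value by at most height
  / (4 d). Fewer than d steps separate \<open>s\<close> from a position attaining the height, so at
  most a quarter of it is lost.\<close>

lemma coord_lower:
  assumes x: "in_kernel x" and s: "s \<le> k"
  shows "3 / 4 * height x \<le> \<bar>coord x s\<bar>"
proof -
  let ?h = "height x / (4 * real d)"
  have step: "\<bar>\<bar>coord x r\<bar> - \<bar>coord x (Suc r)\<bar>\<bar> \<le> ?h" if "r < k" for r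
  proof -
    have "\<bar>\<epsilon> (rs ! r) (cs ! r)\<bar> = 1" "\<bar>\<epsilon> (rs ! r) (cs ! Suc r)\<bar> = 1"
      using sign[OF rs_in cs_in] that by auto
    then have "\<bar>\<bar>coord x r\<bar> - \<bar>coord x (Suc r)\<bar>\<bar>
        \<le> \<bar>\<epsilon> (rs ! r) (cs ! r) * coord x r + \<epsilon> (rs ! r) (cs ! Suc r) * coord x (Suc r)\<bar>"
      using abs_triangle_ineq3[of "\<epsilon> (rs ! r) (cs ! r) * coord x r"
          "- (\<epsilon> (rs ! r) (cs ! Suc r) * coord x (Suc r))"]
      by (simp add: abs_mult)
    then show ?thesis using row_tie_estimate[OF x that] by linarith
  qed
  have dist: "\<bar>\<bar>coord x a\<bar> - \<bar>coord x b\<bar>\<bar> \<le> real (b - a) * ?h" if "a \<le> b" "b \<le> k" for a b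
    using that
  proof (induction b)
    case (Suc b)
    show ?case
    proof (cases "a = Suc b")
      case False
      then have "\<bar>\<bar>coord x a\<bar> - \<bar>coord x b\<bar>\<bar> \<le> real (b - a) * ?h" using Suc by auto
      moreover have "real (Suc b - a) * ?h = real (b - a) * ?h + ?h"
        using False Suc.prems by (simp only: Suc_diff_le of_nat_Suc distrib_right)
      moreover have "\<bar>\<bar>coord x b\<bar> - \<bar>coord x (Suc b)\<bar>\<bar> \<le> ?h" using step Suc.prems by simp
      moreover have "\<bar>\<bar>coord x a\<bar> - \<bar>coord x (Suc b)\<bar>\<bar>
          \<le> \<bar>\<bar>coord x a\<bar> - \<bar>coord x b\<bar>\<bar> + \<bar>\<bar>coord x b\<bar> - \<bar>coord x (Suc b)\<bar>\<bar>"
        using abs_triangle_ineq[of "\<bar>coord x a\<bar> - \<bar>coord x b\<bar>" "\<bar>coord x b\<bar> - \<bar>coord x (Suc b)\<bar>"] by simp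
      ultimately show ?thesis by linarith
    qed simp
  qed simp
  obtain a where a: "a \<le> k" "height x = \<bar>coord x a\<bar>" by (rule height_attained)
  have "\<bar>\<bar>coord x a\<bar> - \<bar>coord x s\<bar>\<bar> \<le> real (max a s - min a s) * ?h"
    using dist[of a s] dist[of s a] a s by (cases "a \<le> s") (auto simp: abs_minus_commute)
  also have "\<dots> \<le> real d * ?h"
    using k_less_d a s by (intro mult_right_mono) auto
  also have "\<dots> = height x / 4" using d_ge_1 by simp
  finally show ?thesis using a by linarith
qed

section \<open>Signs, existence and uniqueness of kernel vectors\<close>

lemma hd_cs: "hd cs = cs ! 0"
  using length_cs by (simp add: hd_conv_nth flip: length_greater_0_conv)

lemma in_set_cs: "j \<in> set cs \<longleftrightarrow> (\<exists>s\<le>k. j = cs ! s)"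
  using length_cs by (auto simp: in_set_conv_nth less_Suc_eq_le)

lemma height_pos:
  assumes "supported x" "j \<in> {1..d}" "x j \<noteq> 0"
  shows "0 < height x"
proof -
  have "j \<in> set cs" using assms by (auto simp: supported_def)
  then obtain s where s: "s \<le> k" "j = cs ! s" by (auto simp: in_set_cs)
  then have "coord x s \<noteq> 0" using assms(3) scale_pos[of s] by (simp add: coord_def)
  then show ?thesis using coord_le_height[OF s(1), of x] by linarith
qed

lemma kernel_nonzero:
  assumes "in_kernel x" "0 < height x" "s \<le> k"
  shows "x (cs ! s) \<noteq> 0"
  using coord_lower[OF assms(1,3)] assms(2) by (auto simp: coord_def)

text \<open>The two dominant terms of a turning row have size at least 3/4 of the height while their
  sum is at most 1/4 of it, so their signs are opposite.\<close>

lemma kernel_sign_change: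
  assumes x: "in_kernel x" and h: "0 < height x" and r: "r < k"
  shows "\<epsilon> (rs ! r) (cs ! r) * \<epsilon> (rs ! r) (cs ! Suc r) * (x (cs ! r) * x (cs ! Suc r)) < 0"
proof -
  define A where "A = \<epsilon> (rs ! r) (cs ! r) * coord x r"
  define B where "B = \<epsilon> (rs ! r) (cs ! Suc r) * coord x (Suc r)"
  have "\<bar>A\<bar> = \<bar>coord x r\<bar>" "\<bar>B\<bar> = \<bar>coord x (Suc r)\<bar>"
    using sign[OF rs_in cs_in] r by (auto simp: A_def B_def abs_mult)
  then have AB: "3 / 4 * height x \<le> \<bar>A\<bar>" "3 / 4 * height x \<le> \<bar>B\<bar>"
    using coord_lower[OF x, of r] coord_lower[OF x, of "Suc r"] r by auto
  have sum: "\<bar>A + B\<bar> \<le> height x / 4"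
    using row_tie_estimate[OF x r] height_div_le[of x] by (simp add: A_def B_def)
  have "A * B < 0"
  proof (cases "0 < A")
    case True
    then have "B < 0" using AB sum h by linarith
    then show ?thesis using True by (simp add: mult_pos_neg)
  next
    case False
    then have "A < 0" "0 < B" using AB sum h by linarith+
    then show ?thesis by (simp add: mult_neg_pos)
  qed
  moreover have pos: "0 < scale r * scale (Suc r)" using scale_pos r by simp
  ultimately have "scale r * scale (Suc r) * (A * B) < 0" by (rule mult_pos_neg[rotated])
  moreover have "scale r * scale (Suc r) * (A * B)
      = \<epsilon> (rs ! r) (cs ! r) * \<epsilon> (rs ! r) (cs ! Suc r) * (x (cs ! r) * x (cs ! Suc r))"
    using scale_pos[of r] scale_pos[of "Suc r"] r by (simp add: A_def B_def coord_def)
  ultimately show ?thesis by simp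
qed

text \<open>The dominant term has relative size at least 3/4 and the error at most 1/4, so the row
  sum takes the sign of the dominant term.\<close>

lemma kernel_gap_sign:
  assumes x: "in_kernel x" and h: "0 < height x" and i: "i \<in> {1..p}" and g: "gap i r"
  shows "0 < \<epsilon> i (cs ! r) * x (cs ! r) * row_sum i x"
proof -
  have r: "r \<le> k" using g by (simp add: gap_def)
  define A where "A = \<epsilon> i (cs ! r) * coord x r"
  define w where "w = weight i r"
  have w: "0 < w" using weight_pos[OF i r] by (simp add: w_def)
  have "\<bar>A\<bar> = \<bar>coord x r\<bar>" using sign[OF i cs_in[OF r]] by (simp add: A_def abs_mult)
  then have A: "height x / 4 < \<bar>A\<bar>" using coord_lower[OF x r] h by linarith
  have "w * (height x / 4) < w * \<bar>A\<bar>" using A w by (rule mult_strict_left_mono)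
  then have "w * (height x / 4) < \<bar>w * A\<bar>" using w by (simp add: abs_mult)
  moreover have "\<bar>row_sum i x - w * A\<bar> \<le> w * (height x / 4)"
    using row_gap_estimate[OF _ i g] x by (simp add: w_def A_def in_kernel_def)
  ultimately have "\<bar>row_sum i x - w * A\<bar> < \<bar>w * A\<bar>" by linarith
  then have "0 < w * A \<and> 0 < row_sum i x \<or> w * A < 0 \<and> row_sum i x < 0" by arith
  then have "0 < A * row_sum i x"
    using w by (auto simp: zero_less_mult_iff mult_less_0_iff)
  then have "0 < scale r * (A * row_sum i x)" using scale_pos[OF r] by simp
  then show ?thesis using scale_pos[OF r] by (simp add: A_def coord_def)
qed

lemma kernel_row_nonzero:
  assumes "in_kernel x" "0 < height x" "i \<in> {1..p}" "i \<notin> set rs"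
  shows "row_sum i x \<noteq> 0"
proof -
  have "sorted_wrt (<) rs" using spec by (simp add: path_spec_def)
  then obtain r where "gap i r"
    using assms(4) unfolding gap_def by (rule strictly_sorted_gap) auto
  then show ?thesis using kernel_gap_sign[OF assms(1-3)] by fastforce
qed

lemma kernel_nonneg_iff_allowed:
  assumes x: "in_kernel x" and pos: "0 < x (hd cs)"
  shows "(\<forall>j\<in>{1..d}. 0 \<le> x j) \<and> (\<forall>i\<in>{1..p}. 0 \<le> row_sum i x) \<longleftrightarrow> allowed_spec p \<epsilon> rs cs"
proof -
  have supp: "supported x" using x by (simp add: in_kernel_def)
  have h: "0 < height x"
    using height_pos[OF supp cs_in[of 0]] pos by (simp add: hd_cs)
  have allowed: "allowed_spec p \<epsilon> rs cs \<longleftrightarrow>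
      (\<forall>r<k. \<epsilon> (rs ! r) (cs ! r) * \<epsilon> (rs ! r) (cs ! Suc r) = -1) \<and>
      (\<forall>i\<in>{1..p}. \<forall>r. gap i r \<longrightarrow> \<epsilon> i (cs ! r) = 1)"
    unfolding allowed_spec_iff[OF spec] gap_def by blast
  show ?thesis
  proof
    assume nn: "(\<forall>j\<in>{1..d}. 0 \<le> x j) \<and> (\<forall>i\<in>{1..p}. 0 \<le> row_sum i x)"
    \<comment> \<open>Kernel entries in the columns of \<open>cs\<close> do not vanish, so
      nonnegative ones are positive.\<close>
    have xpos: "0 < x (cs ! s)" if "s \<le> k" for s
      using nn cs_in[OF that] kernel_nonzero[OF x h that] by force
    have "\<epsilon> (rs ! r) (cs ! r) * \<epsilon> (rs ! r) (cs ! Suc r) = -1" if r: "r < k" for r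
    proof -
      have "0 < x (cs ! r) * x (cs ! Suc r)" using xpos r by simp
      then have "\<epsilon> (rs ! r) (cs ! r) * \<epsilon> (rs ! r) (cs ! Suc r) < 0"
        using kernel_sign_change[OF x h r] mult_less_cancel_right_pos[of _ _ 0] by fastforce
      moreover have "\<bar>\<epsilon> (rs ! r) (cs ! r) * \<epsilon> (rs ! r) (cs ! Suc r)\<bar> = 1"
        using sign[OF rs_in cs_in] r by (simp add: abs_mult)
      ultimately show ?thesis by linarith
    qed
    moreover have "\<epsilon> i (cs ! r) = 1" if i: "i \<in> {1..p}" and g: "gap i r" for i r
    proof -
      have r: "r \<le> k" using g by (simp add: gap_def)
      have "0 < \<epsilon> i (cs ! r) * (x (cs ! r) * row_sum i x)"
        using kernel_gap_sign[OF x h i g] by (simp add: mult_ac)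
      moreover have "0 \<le> x (cs ! r) * row_sum i x" using nn i xpos[OF r] by simp
      ultimately have "0 < \<epsilon> i (cs ! r)" by (auto simp: zero_less_mult_iff)
      then show ?thesis using sign[OF i cs_in[OF r]] by simp
    qed
    ultimately show "allowed_spec p \<epsilon> rs cs" unfolding allowed by blast
  next
    assume al: "allowed_spec p \<epsilon> rs cs"
    \<comment> \<open>Positivity spreads from the first column: by (C4) and the sign change,
      neighbouring entries have a positive product.\<close>
    have xpos: "0 < x (cs ! s)" if "s \<le> k" for s
      using that
    proof (induction s)
      case 0
      then show ?case using pos by (simp add: hd_cs)
    next
      case (Suc s)
      then have "\<epsilon> (rs ! s) (cs ! s) * \<epsilon> (rs ! s) (cs ! Suc s) = -1" using al allowed by simp
      then have "0 < x (cs ! s) * x (cs ! Suc s)"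
        using kernel_sign_change[OF x h, of s] Suc.prems by simp
      then show ?case using Suc by (simp add: zero_less_mult_iff)
    qed
    have "0 \<le> x j" if "j \<in> {1..d}" for j
    proof (cases "j \<in> set cs")
      case True
      then show ?thesis using xpos by (auto simp: in_set_cs less_imp_le)
    next
      case False
      then show ?thesis using supp that by (simp add: supported_def)
    qed
    moreover have "0 \<le> row_sum i x" if i: "i \<in> {1..p}" for i
    proof (cases "i \<in> set rs")
      case True
      then show ?thesis using x by (simp add: in_kernel_def)
    next
      case False
      have "sorted_wrt (<) rs" using spec by (simp add: path_spec_def)
      then obtain r where g: "gap i r"
        using False unfolding gap_def by (rule strictly_sorted_gap) auto
      then have "r \<le> k" "\<epsilon> i (cs ! r) = 1" using al allowed i by (auto simp: gap_def)
      then show ?thesis using kernel_gap_sign[OF x h i g] xpos[of r]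
        by (simp add: zero_less_mult_iff)
    qed
    ultimately show "(\<forall>j\<in>{1..d}. 0 \<le> x j) \<and> (\<forall>i\<in>{1..p}. 0 \<le> row_sum i x)" by blast
  qed
qed

text \<open>A kernel vector vanishing in one column of \<open>cs\<close> is zero, so the kernel is a line.\<close>
lemma kernel_unique:
  assumes x: "in_kernel x" and y: "in_kernel y" and pos: "0 < x (hd cs)" and j: "j \<in> {1..d}"
  shows "y j = y (hd cs) / x (hd cs) * x j"
proof (rule ccontr)
  define c where "c = y (hd cs) / x (hd cs)"
  let ?z = "\<lambda>j. y j + (- c) * x j"
  assume "y j \<noteq> y (hd cs) / x (hd cs) * x j"
  then have "?z j \<noteq> 0" by (simp add: c_def)
  moreover have z: "in_kernel ?z"
    using x y unfolding in_kernel_def supported_def row_sum_add row_sum_scale by simp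
  ultimately have "0 < height ?z" using j by (intro height_pos) (auto simp: in_kernel_def)
  then have "?z (cs ! 0) \<noteq> 0" using kernel_nonzero[OF z, of 0] by blast
  then show False using pos by (simp add: c_def hd_cs)
qed

lemma kernel_exists: "\<exists>x. in_kernel x \<and> 0 < x (hd cs)"
proof -
  have "card (set rs) < card (set cs)"
    using distinct_card[OF distinct_cs] distinct_card[OF distinct_rs] length_cs by simp
  then obtain x where x: "\<exists>j\<in>set cs. x j \<noteq> 0" "\<forall>j. j \<notin> set cs \<longrightarrow> x j = 0"
      "\<forall>i\<in>set rs. (\<Sum>j\<in>set cs. \<epsilon> i j * t i ^ (j - 1) * x j) = 0"
    using underdetermined_system[of "set rs" "set cs" "\<lambda>i j. \<epsilon> i j * t i ^ (j - 1)"] by auto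
  have sub: "set cs \<subseteq> {1..d}" using spec by (simp add: path_spec_def)
  have "row_sum i x = (\<Sum>j\<in>set cs. \<epsilon> i j * t i ^ (j - 1) * x j)" for i
    unfolding row_sum_def using x(2) sub by (intro sum.mono_neutral_right) auto
  then have ker: "in_kernel x" using x by (simp add: in_kernel_def supported_def)
  have "0 < height x" using height_pos[of x] ker x(1) sub by (auto simp: in_kernel_def)
  then have ne: "x (hd cs) \<noteq> 0" using kernel_nonzero[OF ker] by (simp add: hd_cs)
  \<comment> \<open>Multiplying by its own first entry turns that entry into a square, hence
    positive.\<close>
  define y where "y = (\<lambda>j. x (hd cs) * x j)"
  have "in_kernel y" using ker by (simp add: y_def in_kernel_def supported_def row_sum_scale)
  moreover have "0 < y (hd cs)" using ne by (auto simp: y_def zero_less_mult_iff)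
  ultimately show ?thesis by blast
qed

section \<open>Generators of the rays attached to paths\<close>

lemma generator_iff:
  "generator rs cs v \<longleftrightarrow>
     v \<in> carrier_vec d \<and> in_kernel (\<lambda>j. v $ (j - 1)) \<and> 0 < v $ (hd cs - 1)"
  by (auto simp: generator_def in_kernel_def supported_def)

lemma generator_exists: "\<exists>v. generator rs cs v"
proof -
  obtain x where x: "in_kernel x" "0 < x (hd cs)" using kernel_exists by blast
  let ?v = "vec d (\<lambda>j. x (Suc j))"
  have v: "?v $ (j - 1) = x j" if "j \<in> {1..d}" for j using that by auto
  have "row_sum i (\<lambda>j. ?v $ (j - 1)) = row_sum i x" for i by (rule row_sum_cong) (rule v)
  moreover have "hd cs \<in> {1..d}" using cs_in[of 0] by (simp add: hd_cs)
  ultimately have "generator rs cs ?v"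
    using x v by (simp add: generator_def in_kernel_def supported_def)
  then show ?thesis by blast
qed

lemma generator_unique:
  assumes v: "generator rs cs v" and w: "w \<in> carrier_vec d" "in_kernel (\<lambda>j. w $ (j - 1))"
  shows "w = (w $ (hd cs - 1) / v $ (hd cs - 1)) \<cdot>\<^sub>v v"
proof (rule eq_vecI)
  have dims: "dim_vec v = d" "dim_vec w = d" using v w by (auto simp: generator_def)
  then show "dim_vec w = dim_vec ((w $ (hd cs - 1) / v $ (hd cs - 1)) \<cdot>\<^sub>v v)" by simp
  fix j assume "j < dim_vec ((w $ (hd cs - 1) / v $ (hd cs - 1)) \<cdot>\<^sub>v v)"
  then have "j < d" using dims by simp
  then have "w $ j = w $ (hd cs - 1) / v $ (hd cs - 1) * v $ j"
    using kernel_unique[of "\<lambda>j. v $ (j - 1)" "\<lambda>j. w $ (j - 1)" "Suc j"] v w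
    by (simp add: generator_iff)
  then show "w $ j = ((w $ (hd cs - 1) / v $ (hd cs - 1)) \<cdot>\<^sub>v v) $ j"
    using \<open>j < d\<close> by (simp add: dims)
qed

text \<open>The inclusions not built into the definition come from nonvanishing in the columns of
  \<open>cs\<close> and in the rows outside \<open>rs\<close>. Thus the vector determines its
  path.\<close>

lemma generator_zero_sets:
  assumes "generator rs cs v"
  shows "set cs = {j\<in>{1..d}. v $ (j - 1) \<noteq> 0}"
    and "set rs = {i\<in>{1..p}. row_sum i (\<lambda>j. v $ (j - 1)) = 0}"
proof -
  let ?x = "\<lambda>j. v $ (j - 1)"
  have x: "in_kernel ?x" "0 < ?x (hd cs)" using assms by (auto simp: generator_iff)
  then have h: "0 < height ?x"
    using height_pos[of ?x "hd cs"] cs_in[of 0] by (simp add: hd_cs in_kernel_def)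
  show "set cs = {j\<in>{1..d}. v $ (j - 1) \<noteq> 0}"
    using kernel_nonzero[OF x(1) h] x(1) cs_in
    by (fastforce simp: in_kernel_def supported_def in_set_cs)
  have "set rs \<subseteq> {1..p}" using spec by (simp add: path_spec_def)
  then show "set rs = {i\<in>{1..p}. row_sum i ?x = 0}"
    using kernel_row_nonzero[OF x(1) h] x(1) by (auto simp: in_kernel_def)
qed

text \<open>If two nonnegative numbers add up to zero, both are zero. Hence a summand of a multiple
  of \<open>v\<close> inherits the zero entries and active rows of \<open>v\<close>, lies on the
  same kernel line and is a multiple of \<open>v\<close>.\<close>

lemma generator_extreme:
  assumes v: "generator rs cs v" and al: "allowed_spec p \<epsilon> rs cs"
  shows "ray v \<in> extreme_rays (nonneg_cone (signed_vandermonde p d \<epsilon> t))"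
proof -
  let ?K = "nonneg_cone (signed_vandermonde p d \<epsilon> t)"
  have vc: "v \<in> carrier_vec d" and ker: "in_kernel (\<lambda>j. v $ (j - 1))" and pos: "0 < v $ (hd cs - 1)"
    using v by (auto simp: generator_iff)
  have hd: "hd cs \<in> {1..d}" using cs_in[of 0] by (simp add: hd_cs)
  have "v \<in> ?K"
    unfolding mem_cone_iff using kernel_nonneg_iff_allowed[OF ker pos] al vc by simp
  moreover have "v \<noteq> 0\<^sub>v (dim_vec v)"
  proof -
    have "hd cs - 1 < d" using hd by auto
    then show ?thesis using pos vc by (metis carrier_vecD index_zero_vec(1) less_irrefl)
  qed
  moreover have part: "y \<in> ray v" if y: "y \<in> ?K" and z: "z \<in> ?K" and yz: "y + z \<in> ray v" for y z
  proof -
    obtain c where c: "y + z = c \<cdot>\<^sub>v v" using yz by (auto simp: ray_def)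
    have yc: "y \<in> carrier_vec d" "z \<in> carrier_vec d" using y z by (auto simp: mem_cone_iff)
    have entry: "y $ (j - 1) + z $ (j - 1) = c * v $ (j - 1)" if "j \<in> {1..d}" for j
    proof -
      have "(y + z) $ (j - 1) = (c \<cdot>\<^sub>v v) $ (j - 1)" using c by simp
      then show ?thesis using that yc vc by auto
    qed
    have "y $ (j - 1) = 0" if "j \<in> {1..d} - set cs" for j
    proof -
      have "y $ (j - 1) + z $ (j - 1) = 0"
        using entry[of j] that ker by (simp add: in_kernel_def supported_def)
      moreover have "0 \<le> y $ (j - 1)" "0 \<le> z $ (j - 1)" using that y z by (auto simp: mem_cone_iff)
      ultimately show ?thesis by simp
    qed
    moreover have "row_sum i (\<lambda>j. y $ (j - 1)) = 0" if "i \<in> set rs" for i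
    proof -
      have i: "i \<in> {1..p}" using that spec by (auto simp: path_spec_def)
      have "row_sum i (\<lambda>j. y $ (j - 1)) + row_sum i (\<lambda>j. z $ (j - 1))
          = row_sum i (\<lambda>j. c * v $ (j - 1))"
        unfolding row_sum_add[symmetric] using entry by (intro row_sum_cong)
      also have "\<dots> = 0" using ker that by (simp add: row_sum_scale in_kernel_def)
      finally show ?thesis using y z i by (auto simp: mem_cone_iff add_nonneg_eq_0_iff)
    qed
    ultimately have "in_kernel (\<lambda>j. y $ (j - 1))" by (simp add: in_kernel_def supported_def)
    then have "y = (y $ (hd cs - 1) / v $ (hd cs - 1)) \<cdot>\<^sub>v v"
      using generator_unique[OF v yc(1)] by blast
    moreover have "0 \<le> y $ (hd cs - 1) / v $ (hd cs - 1)"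
      using y pos hd by (simp add: mem_cone_iff)
    ultimately show ?thesis unfolding ray_def by blast
  qed
  moreover have "z \<in> ray v" if "y \<in> ?K" "z \<in> ?K" "y + z \<in> ray v" for y z
    using part[of z y] that comm_add_vec[of y d z] by (simp add: mem_cone_iff)
  ultimately show ?thesis unfolding extreme_rays_def by blast
qed

end

section \<open>Extreme rays\<close>

context separated_pattern
begin

lemma lattice_pathI: "path_spec p d rs cs \<Longrightarrow> lattice_path p d \<epsilon> t rs cs"
  by unfold_locales

lemma path_spec_sorted_lists:
  assumes "R \<subseteq> {1..p}" "S \<subseteq> {1..d}" "card S = card R + 1"
  shows "path_spec p d (sorted_list_of_set R) (sorted_list_of_set S)"
proof -
  have "finite R" "finite S" using assms finite_subset by blast+
  then show ?thesis using assms by (simp add: path_spec_def)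
qed

text \<open>The path is read off from the support and the active rows of \<open>v\<close>; once
  their cardinalities fit, nonnegativity of \<open>v\<close> makes it allowed.\<close>

lemma extreme_generator:
  assumes "E \<in> extreme_rays (nonneg_cone (signed_vandermonde p d \<epsilon> t))"
  shows "\<exists>rs cs v. path_spec p d rs cs \<and> allowed_spec p \<epsilon> rs cs \<and> generator rs cs v \<and> E = ray v"
proof -
  let ?K = "nonneg_cone (signed_vandermonde p d \<epsilon> t)"
  obtain v where E: "E = ray v" and v: "v \<in> ?K" "v \<noteq> 0\<^sub>v (dim_vec v)"
    and ext: "\<And>y z. y \<in> ?K \<Longrightarrow> z \<in> ?K \<Longrightarrow> y + z \<in> ray v \<Longrightarrow> y \<in> ray v \<and> z \<in> ray v"
    using assms unfolding extreme_rays_def by blast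
  define x where "x = (\<lambda>j. v $ (j - 1))"
  define S where "S = {j\<in>{1..d}. x j \<noteq> 0}"
  define R where "R = {i\<in>{1..p}. row_sum i x = 0}"
  have vc: "v \<in> carrier_vec d" and xnn: "\<And>j. j \<in> {1..d} \<Longrightarrow> 0 \<le> x j"
    and rnn: "\<And>i. i \<in> {1..p} \<Longrightarrow> 0 \<le> row_sum i x"
    using v by (auto simp: mem_cone_iff x_def)
  have fin: "finite S" "finite R" and sub: "S \<subseteq> {1..d}" "R \<subseteq> {1..p}" by (auto simp: S_def R_def)
  obtain j where "j < d" "v $ j \<noteq> 0" using v(2) vc by (auto simp: vec_eq_iff)
  then have "Suc j \<in> S" by (simp add: S_def x_def)
  then have Sne: "S \<noteq> {}" by blast
  define h where "h = hd (sorted_list_of_set S)"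
  have h: "h \<in> S" "hd (sorted_list_of_set S) = h"
    using Sne fin hd_in_set[of "sorted_list_of_set S"] by (auto simp: h_def)
  then have hpos: "0 < x h" using xnn[of h] by (force simp: S_def)
  \<comment> \<open>Any subset of the active rows will do, which leaves its size free to be adjusted
    to \<open>S\<close>.\<close>
  have gen: "generator (sorted_list_of_set R') (sorted_list_of_set S) v" if "R' \<subseteq> R" for R'
    using that fin finite_subset[OF that fin(2)] vc h hpos
    by (auto simp: generator_def S_def R_def x_def)
  have less: "card R < card S"
  proof (rule ccontr)
    assume "\<not> card R < card S"
    then have "card S - 1 \<le> card R" by simp
    \<comment> \<open>With just enough rows for a path, the row sums outside \<open>R'\<close>
      cannot vanish, contradicting the remaining active row.\<close>
    then obtain R' where R': "R' \<subseteq> R" "card R' = card S - 1" "finite R'"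
      by (rule obtain_subset_with_card_n)
    have "card S > 0" using Sne fin by (simp add: card_gt_0_iff)
    then have "card S = card R' + 1" "R' \<noteq> R" using R' \<open>\<not> card R < card S\<close> by auto
    then obtain i where i: "i \<in> R" "i \<notin> R'" using R' by blast
    have "R' \<subseteq> {1..p}" using R' sub by blast
    then interpret lattice_path p d \<epsilon> t "sorted_list_of_set R'" "sorted_list_of_set S"
      using sub \<open>card S = card R' + 1\<close> by (intro lattice_pathI path_spec_sorted_lists)
    have "set (sorted_list_of_set R') = R"
      using generator_zero_sets(2)[OF gen[OF R'(1)]] by (simp add: R_def x_def)
    then show False using i R' by simp
  qed
  have "card S \<le> card R + 1"
  proof (rule ccontr)
    assume "\<not> card S \<le> card R + 1"
    \<comment> \<open>Index 0 is not a row of the grid; it labels the extra equation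
      \<open>y h = 0\<close>, which keeps \<open>y\<close> from being a nonzero multiple of
      \<open>x\<close>.\<close>
    then have "card (insert 0 R) < card S" using fin by (simp add: card_insert_if)
    then obtain y where y: "\<exists>j\<in>S. y j \<noteq> 0" "\<forall>j. j \<notin> S \<longrightarrow> y j = 0"
        "\<forall>i\<in>insert 0 R. (\<Sum>j\<in>S. (if i = 0 then (if j = h then 1 else 0) else \<epsilon> i j * t i ^ (j - 1)) * y j) = 0"
      using underdetermined_system[of "insert 0 R" S
          "\<lambda>i j. if i = 0 then (if j = h then 1 else 0) else \<epsilon> i j * t i ^ (j - 1)"] fin by auto
    have "(\<Sum>j\<in>S. (if j = h then 1 else 0) * y j) = y h"
      using fin h by (simp add: if_distrib[of "\<lambda>c. c * _"] sum.delta cong: if_cong)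
    then have yh: "y h = 0" using y(3) by simp
    have yrow: "row_sum i y = 0" if "i \<in> R" for i
    proof -
      have "row_sum i y = (\<Sum>j\<in>S. \<epsilon> i j * t i ^ (j - 1) * y j)"
        unfolding row_sum_def using y(2) sub by (intro sum.mono_neutral_right) auto
      moreover have "i \<noteq> 0" using that by (auto simp: R_def)
      ultimately show ?thesis using y(3) that by auto
    qed
    \<comment> \<open>\<open>y\<close> vanishes wherever an entry or a row sum of \<open>x\<close>
      does, so small moves along \<open>y\<close> in both directions stay in the cone.\<close>
    obtain e1 where e1: "0 < e1" "\<forall>j\<in>{1..d}. e1 * \<bar>y j\<bar> \<le> x j"
      using small_perturbation[of "{1..d}" x y] xnn y(2) by (auto simp: S_def)
    obtain e2 where e2: "0 < e2" "\<forall>i\<in>{1..p}. e2 * \<bar>row_sum i y\<bar> \<le> row_sum i x"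
      using small_perturbation[of "{1..p}" "\<lambda>i. row_sum i x" "\<lambda>i. row_sum i y"] rnn yrow
      by (auto simp: R_def)
    define e where "e = min e1 e2"
    have e: "0 < e" using e1 e2 by (simp add: e_def)
    have ej: "e * \<bar>y j\<bar> \<le> x j" if "j \<in> {1..d}" for j
    proof -
      have "e * \<bar>y j\<bar> \<le> e1 * \<bar>y j\<bar>" by (intro mult_right_mono) (auto simp: e_def)
      then show ?thesis using e1(2) that by force
    qed
    have ei: "e * \<bar>row_sum i y\<bar> \<le> row_sum i x" if "i \<in> {1..p}" for i
    proof -
      have "e * \<bar>row_sum i y\<bar> \<le> e2 * \<bar>row_sum i y\<bar>" by (intro mult_right_mono) (auto simp: e_def)
      then show ?thesis using e2(2) that by force
    qed
    define u where "u = (\<lambda>c. vec d (\<lambda>j. x (Suc j) + c * y (Suc j)))"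
    have uj: "u c $ (j - 1) = x j + c * y j" if "j \<in> {1..d}" for c j
      using that by (auto simp: u_def)
    have uK: "u c \<in> ?K" if "\<bar>c\<bar> = e" for c
    proof -
      have bound: "0 \<le> a + c * b" if "e * \<bar>b\<bar> \<le> a" for a b :: real
      proof -
        have "\<bar>c * b\<bar> \<le> a" using that \<open>\<bar>c\<bar> = e\<close> by (simp add: abs_mult)
        then show ?thesis by linarith
      qed
      have "0 \<le> u c $ (j - 1)" if "j \<in> {1..d}" for j
        unfolding uj[OF that] using ej[OF that] by (rule bound)
      moreover have "0 \<le> row_sum i (\<lambda>j. u c $ (j - 1))" if i: "i \<in> {1..p}" for i
      proof -
        have "row_sum i (\<lambda>j. u c $ (j - 1)) = row_sum i (\<lambda>j. x j + c * y j)"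
          by (rule row_sum_cong) (rule uj)
        also have "\<dots> = row_sum i x + c * row_sum i y" by (simp add: row_sum_add row_sum_scale)
        finally show ?thesis using bound[OF ei[OF i]] by simp
      qed
      moreover have "u c \<in> carrier_vec d" by (simp add: u_def)
      ultimately show ?thesis by (simp add: mem_cone_iff)
    qed
    have "u e + u (- e) = 2 \<cdot>\<^sub>v v"
      using vc by (intro eq_vecI) (auto simp: u_def x_def)
    then have "u e + u (- e) \<in> ray v" unfolding ray_def by (auto intro: exI[of _ 2])
    then have "u e \<in> ray v" using ext[OF uK[of e] uK[of "- e"]] e by simp
    then obtain c where c: "u e = c \<cdot>\<^sub>v v" by (auto simp: ray_def)
    have eq: "x j + e * y j = c * x j" if "j \<in> {1..d}" for j
    proof -
      have "u e $ (j - 1) = c * x j" using that vc by (auto simp: c x_def)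
      then show ?thesis using uj[OF that] by simp
    qed
    \<comment> \<open>At \<open>h\<close> the perturbation is zero and \<open>x\<close> is positive,
      which fixes the multiple.\<close>
    have "c = 1" using eq[of h] h sub yh hpos by auto
    then have "y j = 0" if "j \<in> {1..d}" for j using eq[OF that] e by simp
    then show False using y(1) sub by blast
  qed
  then have card: "card S = card R + 1" using less by simp
  interpret lattice_path p d \<epsilon> t "sorted_list_of_set R" "sorted_list_of_set S"
    by (rule lattice_pathI[OF path_spec_sorted_lists[OF sub(2,1) card]])
  have g: "generator (sorted_list_of_set R) (sorted_list_of_set S) v" by (rule gen) simp
  then have "in_kernel x" by (simp add: generator_iff x_def)
  then have "allowed_spec p \<epsilon> (sorted_list_of_set R) (sorted_list_of_set S)"
    using kernel_nonneg_iff_allowed[of x] xnn rnn hpos h by simp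
  then show ?thesis using spec g E by blast
qed

section \<open>The correspondence between rays and paths\<close>

lemma ray_scale:
  assumes "0 < c"
  shows "ray (c \<cdot>\<^sub>v v) = ray v"
proof -
  have "\<exists>b\<ge>0. a \<cdot>\<^sub>v (c \<cdot>\<^sub>v v) = b \<cdot>\<^sub>v v" if "0 \<le> a" for a
    using assms that by (intro exI[of _ "a * c"]) (simp add: smult_smult_assoc)
  moreover have "\<exists>b\<ge>0. a \<cdot>\<^sub>v v = b \<cdot>\<^sub>v (c \<cdot>\<^sub>v v)" if "0 \<le> a" for a
    using assms that by (intro exI[of _ "a / c"]) (simp add: smult_smult_assoc)
  ultimately show ?thesis unfolding ray_def by blast
qed

lemma generator_ray_unique:
  assumes "path_spec p d rs cs" "generator rs cs v" "generator rs cs w"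
  shows "ray v = ray w"
proof -
  interpret lattice_path p d \<epsilon> t rs cs using assms(1) by (rule lattice_pathI)
  have "w = (w $ (hd cs - 1) / v $ (hd cs - 1)) \<cdot>\<^sub>v v"
    using generator_unique[OF assms(2)] assms(3) by (simp add: generator_iff)
  moreover have "0 < w $ (hd cs - 1) / v $ (hd cs - 1)"
    using assms(2,3) by (simp add: generator_def)
  ultimately show ?thesis using ray_scale by metis
qed

text \<open>Nonzero multiples have the same support and the same vanishing rows, and a strictly
  sorted list is determined by its set.\<close>

lemma ray_determines_spec:
  assumes "path_spec p d rs cs" "generator rs cs v" "path_spec p d rs' cs'" "generator rs' cs' w"
    and "ray v = ray w"
  shows "rs = rs' \<and> cs = cs'"
proof -
  have dims: "v \<in> carrier_vec d" "w \<in> carrier_vec d" using assms by (auto simp: generator_def)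
  have "w \<in> ray w" unfolding ray_def by (auto intro: exI[of _ 1])
  then obtain c where c: "w = c \<cdot>\<^sub>v v" using assms(5) by (auto simp: ray_def)
  have entry: "w $ (j - 1) = c * v $ (j - 1)" if "j \<in> {1..d}" for j
    using that dims unfolding c by auto
  have "hd cs' \<in> {1..d}" using assms(3) by (cases cs') (auto simp: path_spec_def)
  then have c0: "c \<noteq> 0" using entry[of "hd cs'"] assms(4) by (auto simp: generator_def)
  have "row_sum i (\<lambda>j. w $ (j - 1)) = row_sum i (\<lambda>j. c * v $ (j - 1))" for i
    using entry by (rule row_sum_cong)
  then have rows: "row_sum i (\<lambda>j. w $ (j - 1)) = 0 \<longleftrightarrow> row_sum i (\<lambda>j. v $ (j - 1)) = 0" for i
    using c0 by (simp add: row_sum_scale)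
  note zero_sets = lattice_path.generator_zero_sets[OF lattice_pathI]
  have "set cs = set cs'"
    using zero_sets(1)[OF assms(1,2)] zero_sets(1)[OF assms(3,4)] entry c0 by auto
  moreover have "set rs = set rs'"
    using zero_sets(2)[OF assms(1,2)] zero_sets(2)[OF assms(3,4)] rows by auto
  ultimately show ?thesis
    using assms(1,3) strict_sorted_equal unfolding path_spec_def by blast
qed

text \<open>Both sides are parametrized bijectively by the set \<open>Q\<close> of allowed turning
  data. The choice of generator does not matter, since all generators of one path span the same
  ray.\<close>

lemma ex_bij_betw_extreme_rays_paths:
  assumes "1 \<le> p"
  shows "\<exists>f. bij_betw f (extreme_rays (nonneg_cone (signed_vandermonde p d \<epsilon> t)))
           (allowed_lattice_paths p d \<epsilon>)"
proof -
  let ?X = "extreme_rays (nonneg_cone (signed_vandermonde p d \<epsilon> t))"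
  define Q where "Q = {(rs, cs). path_spec p d rs cs \<and> allowed_spec p \<epsilon> rs cs}"
  define path where "path = (\<lambda>(rs, cs). path_from p 1 rs cs)"
  define g where "g = (\<lambda>(rs, cs). ray (SOME v. generator rs cs v))"
  have some: "generator rs cs (SOME v. generator rs cs v)" if "path_spec p d rs cs" for rs cs
    using lattice_path.generator_exists[OF lattice_pathI[OF that]] by (rule someI_ex)
  have "bij_betw path Q (allowed_lattice_paths p d \<epsilon>)"
  proof (rule bij_betw_imageI)
    show "inj_on path Q"
      using path_from_inj[where a = 1 and p = p] assms
      by (auto simp: inj_on_def Q_def path_def path_spec_def subset_iff)
    show "path ` Q = allowed_lattice_paths p d \<epsilon>"
      by (auto simp: Q_def path_def allowed_lattice_paths_def image_iff)
  qed
  moreover have "bij_betw g Q ?X"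
  proof (rule bij_betw_imageI)
    show "inj_on g Q"
      using ray_determines_spec[OF _ some _ some] by (auto simp: inj_on_def Q_def g_def)
    show "g ` Q = ?X"
    proof
      show "g ` Q \<subseteq> ?X"
        using lattice_path.generator_extreme[OF lattice_pathI] some by (auto simp: Q_def g_def)
      show "?X \<subseteq> g ` Q"
      proof
        fix E assume "E \<in> ?X"
        then obtain rs cs v where E: "path_spec p d rs cs" "allowed_spec p \<epsilon> rs cs"
            "generator rs cs v" "E = ray v"
          using extreme_generator by blast
        then have "E = g (rs, cs)"
          using generator_ray_unique[OF E(1) E(3) some[OF E(1)]] by (simp add: g_def)
        then show "E \<in> g ` Q" using E by (auto simp: Q_def)
      qed
    qed
  qed
  ultimately show ?thesis using bij_betw_trans[OF bij_betw_inv_into] by blast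
qed

end

theorem theorem12:
  fixes p d :: nat and \<epsilon> :: "nat \<Rightarrow> nat \<Rightarrow> real"
  assumes "1 \<le> p" and "1 \<le> d"
    and "\<forall>i\<in>{1..p}. \<forall>j\<in>{1..d}. \<epsilon> i j \<in> {1, -1}"
  shows "\<exists>M>0. \<forall>t :: nat \<Rightarrow> real.
           0 < t 1 \<and> (\<forall>i\<in>{1..<p}. t i < t (i + 1)) \<and> (\<forall>i\<in>{1..<p}. t (i + 1) / t i > M) \<longrightarrow>
           (\<exists>f. bij_betw f (extreme_rays (nonneg_cone (signed_vandermonde p d \<epsilon> t)))
                           (allowed_lattice_paths p d \<epsilon>))"
proof (intro exI[of _ "4 * (real d)\<^sup>2"] conjI allI impI)
  \<comment> \<open>The bound M = 4 d^2 depends only on the number of columns.\<close>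
  show "0 < 4 * (real d)\<^sup>2" using assms(2) by simp
  fix t :: "nat \<Rightarrow> real"
  assume t: "0 < t 1 \<and> (\<forall>i\<in>{1..<p}. t i < t (i + 1)) \<and>
    (\<forall>i\<in>{1..<p}. t (i + 1) / t i > 4 * (real d)\<^sup>2)"
  have t_pos: "0 < t i" if "1 \<le> i" "i \<le> p" for i
    using that
  proof (induction i rule: nat_induct_at_least)
    case base
    then show ?case using t by simp
  next
    case (Suc i)
    then have "0 < t i" "t i < t (i + 1)" using t by auto
    then show ?case by simp
  qed
  have "separated_pattern p d \<epsilon> t"
  proof
    show "\<bar>\<epsilon> i j\<bar> = 1" if "i \<in> {1..p}" "j \<in> {1..d}" for i j using assms(3) that by fastforce
    show "0 < t i" if "i \<in> {1..p}" for i using t_pos that by simp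
    fix i i' assume i: "i \<in> {1..p}" "i' \<in> {1..p}" "i < i'"
    \<comment> \<open>The hypothesis compares consecutive rows; chaining extends it to all
      pairs.\<close>
    show "4 * (real d)\<^sup>2 * t i \<le> t i'"
    proof (rule geometric_chain[OF i(3) four_times_square_ge_1[OF assms(2)]])
      show "0 \<le> t u" if "i \<le> u" "u \<le> i'" for u using t_pos[of u] that i by simp
      show "4 * (real d)\<^sup>2 * t u \<le> t (Suc u)" if "i \<le> u" "u < i'" for u
      proof -
        have "u \<in> {1..<p}" using that i by auto
        then have "4 * (real d)\<^sup>2 < t (Suc u) / t u" "0 < t u" using t t_pos by auto
        then show ?thesis by (simp add: pos_less_divide_eq less_imp_le)
      qed
    qed
  qed (rule assms(2))
  then show "\<exists>f. bij_betw f (extreme_rays (nonneg_cone (signed_vandermonde p d \<epsilon> t)))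
      (allowed_lattice_paths p d \<epsilon>)"
    using assms(1) by (rule separated_pattern.ex_bij_betw_extreme_rays_paths)
qed

end
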